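(* For every $\tau\in\mathbb{H}^2$, $$\frac{\theta'[\frac13,1]}{\theta[\frac13,1]}=-\frac13\,\frac{\theta'[1,1]\,\theta^3[\frac13,1]}{\theta[0,1]\,\theta^3[\frac23,1]}+\frac{\theta'[1,1]\,\theta[0,1]\,\theta[\frac13,0]\,\theta[\frac23,0]}{\theta[0,0]\,\theta[1,0]\,\theta[\frac13,1]\,\theta[\frac23,1]}$$ $$=\frac{\pi}{3}\,\theta[0,0]\,\theta[1,0]\,\frac{\theta^3[\frac13,1]}{\theta^3[\frac23,1]}-\pi\,\theta^2[0,1]\,\frac{\theta[\frac13,0]\,\theta[\frac23,0]}{\theta[\frac13,1]\,\theta[\frac23,1]}.$$
   Context: $\mathbb{H}^2=\{\tau\in\mathbb{C} : \Im\tau>0\}$ is the upper half plane. For $\epsilon,\epsilon'\in\mathbb{R}$, $\zeta\in\mathbb{C}$, $\tau\in\mathbb{H}^2$, the theta function with characteristics is $$\theta[\epsilon,\epsilon'](\zeta,\tau)=\sum_{n\in\mathbb{Z}}\exp\left(2\pi i\left[\tfrac12\left(n+\tfrac{\epsilon}{2}\right)^2\tau+\left(n+\tfrac{\epsilon}{2}\right)\left(\zeta+\tfrac{\epsilon'}{2}\right)\right]\right).$$ Write $\theta[\epsilon,\epsilon']=\theta[\epsilon,\epsilon'](0,\tau)$ and $\theta'[\epsilon,\epsilon']=\frac{\partial}{\partial\zeta}\theta[\epsilon,\epsilon'](\zeta,\tau)\big|_{\zeta=0}$; $\theta^k[\epsilon,\epsilon']$ means the $k$-th power of $\theta[\epsilon,\epsilon']$.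 *)

theory Defs
  imports "HOL-Analysis.Analysis"
begin

(* The series converges absolutely for Im \<tau> > 0, so the unordered sum over the integers is the
   intended one. *)
definition theta_char :: "real \<Rightarrow> real \<Rightarrow> complex \<Rightarrow> complex \<Rightarrow> complex" where
  "theta_char \<epsilon> \<epsilon>' \<zeta> \<tau> =
     (\<Sum>\<^sub>\<infinity>n\<in>(UNIV :: int set).
        exp (2 * of_real pi * \<i> *
          (1 / 2 * (of_int n + of_real \<epsilon> / 2) ^ 2 * \<tau>
           + (of_int n + of_real \<epsilon> / 2) * (\<zeta> + of_real \<epsilon>' / 2))))"

definition theta_const :: "real \<Rightarrow> real \<Rightarrow> complex \<Rightarrow> complex" where
  "theta_const \<epsilon> \<epsilon>' \<tau> = theta_char \<epsilon> \<epsilon>' 0 \<tau>"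

definition theta_deriv_const :: "real \<Rightarrow> real \<Rightarrow> complex \<Rightarrow> complex" where
  "theta_deriv_const \<epsilon> \<epsilon>' \<tau> = deriv (\<lambda>\<zeta>. theta_char \<epsilon> \<epsilon>' \<zeta> \<tau>) 0"

end

theory Submission
  imports Defs "HOL-Complex_Analysis.Complex_Analysis" "HOL-Real_Asymp.Real_Asymp"
begin

text \<open>
  Put \<open>u = - \<tau>/3\<close>. Up to elementary factors the constants with characteristics \<open>[1/3,1]\<close>, \<open>[2/3,1]\<close>,
  \<open>[1/3,0]\<close>, \<open>[2/3,0]\<close> are the values at \<open>u\<close> of the Jacobi functions \<open>\<theta>\<^sub>1\<close>, \<open>\<theta>\<^sub>4\<close>, \<open>\<theta>\<^sub>2\<close>,
  \<open>\<theta>\<^sub>3\<close>, and the left-hand side is \<open>\<theta>\<^sub>1'(u)/\<theta>\<^sub>1(u) - 2 \<pi> \<i>/3\<close>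
  (\<open>theta_const_third_characteristics\<close>). In the language of elliptic functions the first equality comes from
  \<open>\<theta>\<^sub>1'/\<theta>\<^sub>1 = Z + cn dn / sn\<close> with \<open>Z = \<theta>\<^sub>4'/\<theta>\<^sub>4\<close>
  (\<open>theta1_log_deriv_eq_theta4_log_deriv\<close>), where \<open>Z(u)\<close> is a multiple of \<open>sn(u)\<^sup>3\<close> plus a constant. The latter
  holds since \<open>u\<close> has order three: in the duplication formula
  \<open>Z(2u) = 2 Z(u) - k\<^sup>2 sn(u)\<^sup>2 sn(2u)\<close> (\<open>theta4_log_deriv_double_argument\<close>) the point \<open>2u\<close> is
  \<open>- u\<close> up to a period, hence \<open>Z(2u) = - Z(u)\<close> up to a constant and \<open>sn(2u) = - sn(u)\<close>, so that the formula can be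
  solved for \<open>Z(u)\<close> (\<open>theta4_log_deriv_third_period\<close>).

  The second equality is Jacobi's derivative formula \<open>\<theta>'[1,1] = - \<pi> \<theta>[0,0] \<theta>[1,0] \<theta>[0,1]\<close>
  (\<open>jacobi_derivative_formula\<close>).

  All product relations between theta functions come from one identity, \<open>theta_series_mult\<close>, which writes a product of
  two theta series at \<open>\<tau>\<close> as a sum of two products at \<open>2 \<tau>\<close>. It yields the derivative of
  \<open>\<theta>\<^sub>1/\<theta>\<^sub>4\<close> (\<open>wronskian_theta1_theta4\<close>), the addition formula \<open>theta4_addition\<close>, and the behaviour of theta
  constants under \<open>\<tau> \<mapsto> 2 \<tau>\<close>. Iterating the last point moves \<open>\<tau>\<close> to \<open>2 ^ k * \<tau>\<close>,
  where the series are governed by their leading terms (\<open>theta_leading_term\<close>). This shows both that the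
  denominators do not vanish and that the invariant quotient in Jacobi's formula has the value \<open>- \<pi>\<close>.
\<close>

section \<open>Convergence and differentiability of theta series\<close>

lemma summable_on_exp_neg_abs_int: "(\<lambda>n::int. exp (- \<bar>real_of_int n\<bar>)) summable_on UNIV"
proof -
  have geo: "(\<lambda>k::nat. exp (- real k)) summable_on UNIV"
  proof -
    have "summable (\<lambda>k::nat. exp (- 1 :: real) ^ k)"
      by (intro summable_geometric) simp
    then have "summable (\<lambda>k::nat. exp (- real k))"
      by (simp add: exp_of_nat_mult [symmetric])
    then show ?thesis
      by (subst summable_on_UNIV_nonneg_real_iff) auto
  qed
  have "(\<lambda>n::int. exp (- \<bar>real_of_int n\<bar>)) summable_on range int"
    by (subst summable_on_reindex) (use geo in \<open>auto simp: o_def\<close>)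
  moreover have "(\<lambda>n::int. exp (- \<bar>real_of_int n\<bar>)) summable_on range (\<lambda>k. - int k)"
    by (subst summable_on_reindex) (use geo in \<open>auto simp: o_def inj_on_def\<close>)
  moreover have "(UNIV :: int set) = range int \<union> range (\<lambda>k. - int k)"
    by (auto intro: int_cases2)
  ultimately show ?thesis
    using summable_on_union by metis
qed

text \<open>
  The majorant behind every convergence statement below. Completing the square bounds the exponent by
  a constant minus \<open>|n + a|\<close>, so a linear perturbation of any size is harmless; that slack is what
  absorbs the factor \<open>n + a\<close> of a derivative and the growth in \<open>Im z\<close>.
\<close>
lemma gaussian_summable:
  fixes \<alpha> \<beta> a :: real
  assumes "\<alpha> > 0"
  shows "(\<lambda>n::int. exp (- \<alpha> * (of_int n + a)\<^sup>2 + \<beta> * \<bar>of_int n + a\<bar>)) summable_on (UNIV :: int set)"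
proof (rule summable_on_comparison_test)
  \<comment> \<open>The maximum of \<open>- \<alpha> t\<^sup>2 + (\<beta> + 1) t\<close>, plus the cost of passing from \<open>|n + a|\<close> to \<open>|n|\<close>.\<close>
  define C where "C = (\<beta> + 1)\<^sup>2 / (4 * \<alpha>) + \<bar>a\<bar>"
  show "(\<lambda>n::int. exp C * exp (- \<bar>real_of_int n\<bar>)) summable_on UNIV"
    by (intro summable_on_cmult_right summable_on_exp_neg_abs_int)
  fix n :: int
  define t where "t = \<bar>of_int n + a\<bar>"
  have "0 \<le> \<alpha> * (t - (\<beta> + 1) / (2 * \<alpha>))\<^sup>2"
    using assms by simp
  also have "\<dots> = \<alpha> * t\<^sup>2 - (\<beta> + 1) * t + (\<beta> + 1)\<^sup>2 / (4 * \<alpha>)"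
    using assms by (simp add: power2_eq_square field_simps)
  finally have "- \<alpha> * t\<^sup>2 + \<beta> * t \<le> (\<beta> + 1)\<^sup>2 / (4 * \<alpha>) - t"
    by (simp add: algebra_simps)
  moreover have "t \<ge> \<bar>of_int n\<bar> - \<bar>a\<bar>"
    unfolding t_def by linarith
  ultimately show "exp (- \<alpha> * (of_int n + a)\<^sup>2 + \<beta> * \<bar>of_int n + a\<bar>) \<le> exp C * exp (- \<bar>real_of_int n\<bar>)"
    unfolding exp_add [symmetric] by (simp add: t_def C_def)
qed auto

text \<open>
  Since \<open>\<theta>[\<epsilon>, \<epsilon>'](\<zeta>)\<close> depends on \<open>\<zeta>\<close> and \<open>\<epsilon>'\<close> only through \<open>\<zeta> + \<epsilon>'/2\<close>, the lower characteristic is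
  absorbed into the argument, and \<open>a\<close> stands for \<open>\<epsilon>/2\<close>.
\<close>
definition theta_term :: "real \<Rightarrow> complex \<Rightarrow> complex \<Rightarrow> int \<Rightarrow> complex" where
  "theta_term a z \<tau> n =
     exp (2 * of_real pi * \<i> * (1 / 2 * (of_int n + of_real a)\<^sup>2 * \<tau> + (of_int n + of_real a) * z))"

definition theta_series :: "real \<Rightarrow> complex \<Rightarrow> complex \<Rightarrow> complex" where
  "theta_series a z \<tau> = (\<Sum>\<^sub>\<infinity>n. theta_term a z \<tau> n)"

definition theta_series_deriv :: "real \<Rightarrow> complex \<Rightarrow> complex \<Rightarrow> complex" where
  "theta_series_deriv a z \<tau> =
     (\<Sum>\<^sub>\<infinity>n. 2 * of_real pi * \<i> * (of_int n + of_real a) * theta_term a z \<tau> n)"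

lemma norm_theta_term:
  "norm (theta_term a z \<tau> n) = exp (- (pi * Im \<tau>) * (of_int n + a)\<^sup>2 - 2 * pi * Im z * (of_int n + a))"
proof -
  define t where "t = real_of_int n + a"
  have t: "of_int n + of_real a = complex_of_real t"
    by (simp add: t_def)
  show ?thesis
    unfolding theta_term_def norm_exp_eq_Re t t_def [symmetric]
    by (simp flip: of_real_power add: algebra_simps)
qed

lemma norm_theta_term_le:
  assumes "\<bar>Im z\<bar> \<le> B" "Im \<tau> \<ge> y"
  shows "norm (theta_term a z \<tau> n) \<le> exp (- (pi * y) * (of_int n + a)\<^sup>2 + 2 * pi * B * \<bar>of_int n + a\<bar>)"
proof -
  define t where "t = real_of_int n + a"
  have "- (Im z * t) \<le> B * \<bar>t\<bar>"
  proof -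
    have "- (Im z * t) \<le> \<bar>Im z\<bar> * \<bar>t\<bar>"
      by (simp flip: abs_mult)
    also have "\<dots> \<le> B * \<bar>t\<bar>"
      using assms(1) by (rule mult_right_mono) simp
    finally show ?thesis .
  qed
  then have "2 * pi * - (Im z * t) \<le> 2 * pi * (B * \<bar>t\<bar>)"
    by (rule mult_left_mono) simp
  moreover have "pi * y * t\<^sup>2 \<le> pi * Im \<tau> * t\<^sup>2"
    using assms(2) by (intro mult_right_mono) auto
  ultimately have "- (pi * Im \<tau> * t\<^sup>2) + 2 * pi * - (Im z * t) \<le> - (pi * y * t\<^sup>2) + 2 * pi * (B * \<bar>t\<bar>)"
    by linarith
  then show ?thesis
    unfolding norm_theta_term t_def [symmetric] exp_le_cancel_iff by (simp add: mult.assoc)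
qed

lemma abs_summable_theta_term:
  assumes "Im \<tau> > 0"
  shows "(\<lambda>n. norm (theta_term a z \<tau> n)) summable_on UNIV"
proof (rule summable_on_comparison_test)
  show "(\<lambda>n. exp (- (pi * Im \<tau>) * (of_int n + a)\<^sup>2 + 2 * pi * \<bar>Im z\<bar> * \<bar>of_int n + a\<bar>)) summable_on (UNIV::int set)"
    using assms by (intro gaussian_summable) simp
qed (use norm_theta_term_le in auto)

lemma theta_term_has_field_derivative:
  "((\<lambda>z. theta_term a z \<tau> n) has_field_derivative
     2 * of_real pi * \<i> * (of_int n + of_real a) * theta_term a z \<tau> n) (at z within X)"
  unfolding theta_term_def
  by (auto intro!: derivative_eq_intros)

text \<open>
  On a disc around \<open>z\<close> the terms have a summable bound that does not depend on the point, so the finite partial sums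
  converge uniformly there; they are entire, hence their derivatives converge as well.
\<close>
lemma theta_series_has_field_derivative:
  assumes "Im \<tau> > 0"
  shows "((\<lambda>z. theta_series a z \<tau>) has_field_derivative theta_series_deriv a z \<tau>) (at z)"
proof -
  define B where "B = \<bar>Im z\<bar> + 1"
  define M where "M = (\<lambda>n::int. exp (- (pi * Im \<tau>) * (of_int n + a)\<^sup>2 + 2 * pi * B * \<bar>of_int n + a\<bar>))"
  have bound: "norm (theta_term a w \<tau> n) \<le> M n" if "w \<in> cball z 1" for w n
  proof -
    have "\<bar>Im z - Im w\<bar> \<le> 1"
      using that abs_Im_le_cmod [of "z - w"] by (simp add: dist_norm)
    then have "\<bar>Im w\<bar> \<le> B"
      unfolding B_def by linarith
    then show ?thesis
      unfolding M_def by (rule norm_theta_term_le) simp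
  qed
  have "M summable_on UNIV"
    unfolding M_def using assms by (intro gaussian_summable) simp
  then have ul: "uniform_limit (cball z 1) (\<lambda>X w. \<Sum>n\<in>X. theta_term a w \<tau> n) (\<lambda>w. theta_series a w \<tau>)
                   (finite_subsets_at_top UNIV)"
    unfolding theta_series_def using bound by (intro Weierstrass_m_test_general) auto
  define D where "D = (\<lambda>w n. 2 * of_real pi * \<i> * (of_int n + of_real a) * theta_term a w \<tau> n)"
  have der: "((\<lambda>w. \<Sum>n\<in>X. theta_term a w \<tau> n) has_field_derivative (\<Sum>n\<in>X. D w n)) (at w within Y)" for X w Y
    unfolding D_def by (intro DERIV_sum theta_term_has_field_derivative)
  have ev: "\<forall>\<^sub>F X in finite_subsets_at_top UNIV. continuous_on (cball z 1) (\<lambda>w. \<Sum>n\<in>X. theta_term a w \<tau> n) \<and>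
      (\<forall>w\<in>ball z 1. ((\<lambda>w. \<Sum>n\<in>X. theta_term a w \<tau> n) has_field_derivative (\<Sum>n\<in>X. D w n)) (at w))"
    by (intro always_eventually allI conjI ballI der DERIV_continuous_on [OF der])
  obtain g' where g':
    "\<And>w. w \<in> ball z 1 \<Longrightarrow> ((\<lambda>w. theta_series a w \<tau>) has_field_derivative g' w) (at w)
        \<and> ((\<lambda>X. \<Sum>n\<in>X. D w n) \<longlongrightarrow> g' w) (finite_subsets_at_top UNIV)"
    using has_complex_derivative_uniform_limit [OF ev ul] by auto
  have "(D z has_sum g' z) UNIV"
    using g' [of z] by (simp add: has_sum_def)
  then have "g' z = theta_series_deriv a z \<tau>"
    unfolding theta_series_deriv_def D_def by (rule infsumI [symmetric])
  then show ?thesis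
    using g' [of z] by simp
qed

section \<open>The multiplication formula\<close>

lemma infsum_times_infsum:
  fixes f :: "'a \<Rightarrow> complex" and g :: "'b \<Rightarrow> complex"
  assumes "(\<lambda>x. norm (f x)) summable_on UNIV" "(\<lambda>x. norm (g x)) summable_on UNIV"
  shows "(\<lambda>(x, y). f x * g y) summable_on UNIV"
    and "infsum f UNIV * infsum g UNIV = (\<Sum>\<^sub>\<infinity>(x, y). f x * g y)"
proof -
  have "(\<lambda>p. norm (f (fst p) * g (snd p))) summable_on Sigma UNIV (\<lambda>_. UNIV)"
    using assms
    by (intro Infinite_Sum.abs_summable_on_Sigma_iff [THEN iffD2])
       (simp add: norm_mult infsum_cmult_right' summable_on_cmult_left summable_on_cmult_right infsum_nonneg)
  then have "(\<lambda>p. norm (case p of (x, y) \<Rightarrow> f x * g y)) summable_on UNIV"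
    by (simp add: case_prod_unfold)
  then show s: "(\<lambda>(x, y). f x * g y) summable_on UNIV"
    by (rule abs_summable_summable)
  have "(\<Sum>\<^sub>\<infinity>x. \<Sum>\<^sub>\<infinity>y. f x * g y) = (\<Sum>\<^sub>\<infinity>(x, y)\<in>UNIV \<times> UNIV. f x * g y)"
    using s by (intro infsum_Sigma'_banach) simp
  then show "infsum f UNIV * infsum g UNIV = (\<Sum>\<^sub>\<infinity>(x, y). f x * g y)"
    by (simp add: infsum_cmult_right' infsum_cmult_left')
qed

text \<open>
  The parallelogram law \<open>(K + J)\<^sup>2 + (K - J)\<^sup>2 = 2 K\<^sup>2 + 2 J\<^sup>2\<close>: a rotation of the index lattice by 45 degrees
  splits a product at \<open>\<tau>\<close> into a product at \<open>2 \<tau>\<close>.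
\<close>
lemma theta_term_mult_theta_term:
  fixes m n k j :: int
  assumes "of_int m + a = (of_int k + c) + (of_int j + d)"
    and "of_int n + b = (of_int k + c) - (of_int j + d)"
  shows "theta_term a (x + y) \<tau> m * theta_term b (x - y) \<tau> n =
           theta_term c (2 * x) (2 * \<tau>) k * theta_term d (2 * y) (2 * \<tau>) j"
proof -
  have *: "of_int i + of_real r = complex_of_real (of_int i + r)" for i r
    by simp
  have quad: "2 * of_real pi * \<i> * (1 / 2 * (K + J)\<^sup>2 * \<tau> + (K + J) * (x + y)) +
         2 * of_real pi * \<i> * (1 / 2 * (K - J)\<^sup>2 * \<tau> + (K - J) * (x - y)) =
        2 * of_real pi * \<i> * (1 / 2 * K\<^sup>2 * (2 * \<tau>) + K * (2 * x)) +
         2 * of_real pi * \<i> * (1 / 2 * J\<^sup>2 * (2 * \<tau>) + J * (2 * y))" for K J :: complex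
    by (simp add: power2_eq_square field_simps)
  show ?thesis
    unfolding theta_term_def exp_add [symmetric] * assms of_real_add [of "_ + _" "_ + _"] of_real_diff
    by (rule arg_cong [where f = exp], rule quad)
qed

text \<open>
  The pairs \<open>(k + j, k - j)\<close> are exactly the index pairs with even sum and the pairs
  \<open>(k + j + 1, k - j)\<close> those with odd sum; each class contributes one product. In the odd class the
  substitution shifts both new indices by \<open>1/2\<close>.
\<close>
lemma theta_series_mult:
  assumes "Im \<tau> > 0"
  shows "theta_series (a + b) (x + y) \<tau> * theta_series (a - b) (x - y) \<tau> =
           theta_series a (2 * x) (2 * \<tau>) * theta_series b (2 * y) (2 * \<tau>)
         + theta_series (a + 1 / 2) (2 * x) (2 * \<tau>) * theta_series (b + 1 / 2) (2 * y) (2 * \<tau>)"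
proof -
  define \<phi> where "\<phi> = (\<lambda>(k::int, j::int). (k + j, k - j))"
  define \<psi> where "\<psi> = (\<lambda>(k::int, j::int). (k + j + 1, k - j))"
  define h where "h = (\<lambda>(m, n). theta_term (a + b) (x + y) \<tau> m * theta_term (a - b) (x - y) \<tau> n)"
  have \<tau>2: "Im (2 * \<tau>) > 0"
    using assms by simp
  note abs = abs_summable_theta_term [OF assms] and abs2 = abs_summable_theta_term [OF \<tau>2]
  have inj: "inj \<phi>" "inj \<psi>"
    by (auto simp: inj_on_def \<phi>_def \<psi>_def)
  have range_iff: "p \<in> range \<phi> \<longleftrightarrow> even (fst p + snd p)" "p \<in> range \<psi> \<longleftrightarrow> odd (fst p + snd p)" for p
  proof -
    have "p \<in> range \<phi>" if "fst p + snd p = 2 * k" for k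
      using that by (intro image_eqI [of _ _ "(k, fst p - k)"]) (simp_all add: \<phi>_def prod_eq_iff)
    moreover have "p \<in> range \<psi>" if "fst p + snd p = 2 * k + 1" for k
      using that by (intro image_eqI [of _ _ "(k, fst p - k - 1)"]) (simp_all add: \<psi>_def prod_eq_iff)
    moreover have "even (fst p + snd p)" if "p \<in> range \<phi>"
      using that by (auto simp: \<phi>_def)
    moreover have "odd (fst p + snd p)" if "p \<in> range \<psi>"
      using that by (auto simp: \<psi>_def)
    ultimately show "p \<in> range \<phi> \<longleftrightarrow> even (fst p + snd p)" "p \<in> range \<psi> \<longleftrightarrow> odd (fst p + snd p)"
      by (meson evenE oddE)+
  qed
  have disj: "range \<phi> \<inter> range \<psi> = {}"
    by (simp only: set_eq_iff Int_iff empty_iff range_iff) blast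
  have cover: "range \<phi> \<union> range \<psi> = UNIV"
    by (simp only: set_eq_iff Un_iff range_iff UNIV_I) blast
  have h\<phi>: "h (\<phi> (k, j)) = theta_term a (2 * x) (2 * \<tau>) k * theta_term b (2 * y) (2 * \<tau>) j" for k j
    unfolding h_def \<phi>_def prod.case by (rule theta_term_mult_theta_term) (simp_all add: field_simps)
  have h\<psi>: "h (\<psi> (k, j)) = theta_term (a + 1 / 2) (2 * x) (2 * \<tau>) k * theta_term (b + 1 / 2) (2 * y) (2 * \<tau>) j" for k j
    unfolding h_def \<psi>_def prod.case by (rule theta_term_mult_theta_term) (simp_all add: field_simps)
  have sum: "h summable_on UNIV"
    unfolding h_def by (rule infsum_times_infsum(1)) (rule abs)+
  have "theta_series (a + b) (x + y) \<tau> * theta_series (a - b) (x - y) \<tau> = infsum h UNIV"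
    unfolding theta_series_def h_def by (rule infsum_times_infsum(2)) (rule abs)+
  also have "\<dots> = infsum h (range \<phi> \<union> range \<psi>)"
    by (simp add: cover)
  also have "\<dots> = infsum h (range \<phi>) + infsum h (range \<psi>)"
    by (intro infsum_Un_disjoint disj summable_on_subset_banach [OF sum]) auto
  also have "\<dots> = infsum (h \<circ> \<phi>) UNIV + infsum (h \<circ> \<psi>) UNIV"
    using inj by (simp add: infsum_reindex)
  also have "infsum (h \<circ> \<phi>) UNIV
      = theta_series a (2 * x) (2 * \<tau>) * theta_series b (2 * y) (2 * \<tau>)"
    unfolding theta_series_def infsum_times_infsum(2) [OF abs2 abs2]
    by (intro infsum_cong) (auto simp: h\<phi>)
  also have "infsum (h \<circ> \<psi>) UNIV
      = theta_series (a + 1 / 2) (2 * x) (2 * \<tau>) * theta_series (b + 1 / 2) (2 * y) (2 * \<tau>)"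
    unfolding theta_series_def infsum_times_infsum(2) [OF abs2 abs2]
    by (intro infsum_cong) (auto simp: h\<psi>)
  finally show ?thesis .
qed

section \<open>Symmetries and translations\<close>

lemma theta_series_char_add_1: "theta_series (a + 1) z \<tau> = theta_series a z \<tau>"
proof -
  have "theta_series a z \<tau> = (\<Sum>\<^sub>\<infinity>n. theta_term a z \<tau> (n + 1))"
    unfolding theta_series_def
    by (rule infsum_reindex_bij_betw [symmetric]) (rule bij_betwI [of _ _ _ "\<lambda>n. n - 1"], auto)
  also have "\<dots> = theta_series (a + 1) z \<tau>"
    unfolding theta_series_def theta_term_def by (simp add: add_ac)
  finally show ?thesis ..
qed

lemma theta_series_minus: "theta_series (- a) (- z) \<tau> = theta_series a z \<tau>"
proof -
  have *: "theta_term (- a) (- z) \<tau> (- n) = theta_term a z \<tau> n" for n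
  proof -
    have "complex_of_int (- n) + of_real (- a) = - (of_int n + of_real a)"
      by simp
    then show ?thesis
      unfolding theta_term_def by (simp only: power2_minus minus_mult_minus)
  qed
  have "theta_series (- a) (- z) \<tau> = (\<Sum>\<^sub>\<infinity>n. theta_term (- a) (- z) \<tau> (- n))"
    unfolding theta_series_def
    by (rule infsum_reindex_bij_betw [symmetric]) (rule bij_betwI [of _ _ _ uminus], auto)
  then show ?thesis
    by (simp only: * theta_series_def)
qed

lemma theta_series_add_1: "theta_series a (z + 1) \<tau> = exp (2 * of_real pi * \<i> * of_real a) * theta_series a z \<tau>"
proof -
  have "theta_term a (z + 1) \<tau> n = exp (2 * of_real pi * \<i> * of_real a) * theta_term a z \<tau> n" for n
  proof -
    have "theta_term a (z + 1) \<tau> n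
      = exp (2 * of_real pi * \<i> * of_real a) * theta_term a z \<tau> n * exp (2 * of_int n * of_real pi * \<i>)"
      unfolding theta_term_def exp_add [symmetric] by (rule arg_cong [where f = exp]) (simp add: algebra_simps)
    then show ?thesis
      using exp_integer_2pi [of "of_int n"] by (simp add: mult_ac)
  qed
  then show ?thesis
    by (simp only: theta_series_def infsum_cmult_right')
qed

text \<open>
  Translating the argument by a real multiple of \<open>\<tau>\<close> changes the characteristic, by completing the square in the exponent.
  In this way theta constants with fractional characteristic become values at torsion points.
\<close>
lemma theta_series_char_add:
  "theta_series (a + b) z \<tau> =
     exp (2 * of_real pi * \<i> * (1 / 2 * (of_real b)\<^sup>2 * \<tau> + of_real b * z)) * theta_series a (z + of_real b * \<tau>) \<tau>"
proof -
  have "theta_term (a + b) z \<tau> n =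
     exp (2 * of_real pi * \<i> * (1 / 2 * (of_real b)\<^sup>2 * \<tau> + of_real b * z)) * theta_term a (z + of_real b * \<tau>) \<tau> n" for n
    unfolding theta_term_def exp_add [symmetric]
    by (rule arg_cong [where f = exp]) (simp add: power2_eq_square field_simps)
  then show ?thesis
    by (simp only: theta_series_def infsum_cmult_right')
qed

lemma theta_series_has_field_derivative' [derivative_intros]:
  assumes "(g has_field_derivative g') (at z)" "Im \<tau> > 0"
  shows "((\<lambda>z. theta_series a (g z) \<tau>) has_field_derivative theta_series_deriv a (g z) \<tau> * g') (at z)"
  by (rule DERIV_chain2 [OF theta_series_has_field_derivative assms(1)]) fact

lemma theta_series_deriv_char_add:
  assumes "Im \<tau> > 0"
  shows "theta_series_deriv (a + b) z \<tau> =
     exp (2 * of_real pi * \<i> * (1 / 2 * (of_real b)\<^sup>2 * \<tau> + of_real b * z)) *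
       (theta_series_deriv a (z + of_real b * \<tau>) \<tau>
        + 2 * of_real pi * \<i> * of_real b * theta_series a (z + of_real b * \<tau>) \<tau>)"
proof -
  note D = theta_series_has_field_derivative [OF assms]
  show ?thesis
    by (rule DERIV_unique [OF D [of "a + b" z]], unfold theta_series_char_add)
       (auto intro!: derivative_eq_intros assms simp: algebra_simps)
qed

lemma theta_series_deriv_minus:
  assumes "Im \<tau> > 0"
  shows "theta_series_deriv (- a) (- z) \<tau> = - theta_series_deriv a z \<tau>"
proof -
  note D = theta_series_has_field_derivative [OF assms]
  have "((\<lambda>z. theta_series (- a) (- z) \<tau>) has_field_derivative - theta_series_deriv (- a) (- z) \<tau>) (at z)"
    by (auto intro!: derivative_eq_intros assms)
  then have "((\<lambda>z. theta_series a z \<tau>) has_field_derivative - theta_series_deriv (- a) (- z) \<tau>) (at z)"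
    by (simp only: theta_series_minus)
  from DERIV_unique [OF this D] show ?thesis
    by (metis minus_minus)
qed

lemma theta_series_deriv_add_1:
  assumes "Im \<tau> > 0"
  shows "theta_series_deriv a (z + 1) \<tau> = exp (2 * of_real pi * \<i> * of_real a) * theta_series_deriv a z \<tau>"
proof -
  note D = theta_series_has_field_derivative [OF assms]
  have "((\<lambda>z. theta_series a (z + 1) \<tau>) has_field_derivative theta_series_deriv a (z + 1) \<tau>) (at z)"
    by (auto intro!: derivative_eq_intros assms)
  then have "((\<lambda>z. exp (2 * of_real pi * \<i> * of_real a) * theta_series a z \<tau>)
      has_field_derivative theta_series_deriv a (z + 1) \<tau>) (at z)"
    by (simp only: theta_series_add_1)
  from DERIV_unique [OF this DERIV_cmult [OF D]] show ?thesis .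
qed

section \<open>Behaviour along repeated doubling of the modulus\<close>

text \<open>
  Dominated convergence for unordered sums: the finite partial sums converge uniformly in the parameter,
  which permits exchanging the two limits.
\<close>
lemma tendsto_infsum_dominated:
  fixes f :: "'a \<Rightarrow> 'b \<Rightarrow> 'c :: banach"
  assumes "\<And>x. ((\<lambda>k. f x k) \<longlongrightarrow> g x) F" "\<And>x k. norm (f x k) \<le> M x" "M summable_on UNIV" "F \<noteq> bot"
  shows "((\<lambda>k. \<Sum>\<^sub>\<infinity>x. f x k) \<longlongrightarrow> (\<Sum>\<^sub>\<infinity>x. g x)) F"
proof (rule swap_uniform_limit')
  show "uniform_limit UNIV (\<lambda>X k. \<Sum>x\<in>X. f x k) (\<lambda>k. \<Sum>\<^sub>\<infinity>x. f x k) (finite_subsets_at_top UNIV)"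
    using assms by (intro Weierstrass_m_test_general) auto
  have "norm (g x) \<le> M x" for x
    by (rule tendsto_upperbound [OF tendsto_norm [OF assms(1)] _ assms(4)]) (simp add: assms(2))
  then have "(\<lambda>x. norm (g x)) summable_on UNIV"
    by (rule summable_on_comparison_test [OF assms(3)]) simp_all
  then have "g summable_on UNIV"
    by (rule abs_summable_summable)
  then show "((\<lambda>X. \<Sum>x\<in>X. g x) \<longlongrightarrow> (\<Sum>\<^sub>\<infinity>x. g x)) (finite_subsets_at_top UNIV)"
    by (rule infsum_tendsto)
  show "\<forall>\<^sub>F X in finite_subsets_at_top UNIV. ((\<lambda>k. \<Sum>x\<in>X. f x k) \<longlongrightarrow> (\<Sum>x\<in>X. g x)) F"
    by (intro always_eventually allI tendsto_sum assms)
qed auto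

text \<open>
  As \<open>k\<close> grows, \<open>Im (2 ^ k * \<tau>)\<close> tends to infinity and only the terms with the least value \<open>m\<^sup>2\<close> of
  \<open>(n + a)\<^sup>2\<close> survive. The coefficients \<open>p\<close> allow the same statement to serve for the series
  and for its derivative.
\<close>
lemma theta_leading_term:
  assumes \<tau>: "Im \<tau> > 0"
    and least: "\<And>n. m\<^sup>2 \<le> (of_int n + a)\<^sup>2"
    and p: "\<And>n. norm (p n) \<le> K * exp \<bar>of_int n + a\<bar>"
  shows "(\<lambda>k. exp (- (of_real pi * \<i> * (of_real m)\<^sup>2 * (2 ^ k * \<tau>))) * (\<Sum>\<^sub>\<infinity>n. p n * theta_term a z (2 ^ k * \<tau>) n))
           \<longlonglongrightarrow> (\<Sum>n | (of_int n + a)\<^sup>2 = m\<^sup>2. p n * exp (2 * of_real pi * \<i> * (of_int n + of_real a) * z))"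
proof -
  define d where "d n = (of_int n + a)\<^sup>2 - m\<^sup>2" for n
  define c where "c n = p n * exp (2 * of_real pi * \<i> * (of_int n + of_real a) * z)" for n
  define f where "f n k = c n * exp (of_real pi * \<i> * of_real (d n) * (2 ^ k * \<tau>))" for n k
  \<comment> \<open>The exponential factor of \<open>f n k\<close> decreases in \<open>k\<close>, so a bound at \<open>k = 0\<close> is uniform.\<close>
  define M where "M n = K * exp (pi * m\<^sup>2 * Im \<tau>) *
      exp (- (pi * Im \<tau>) * (of_int n + a)\<^sup>2 + (1 + 2 * pi * \<bar>Im z\<bar>) * \<bar>of_int n + a\<bar>)" for n
  have d0: "d n \<ge> 0" for n
    using least by (simp add: d_def)
  have K: "K \<ge> 0"
    using order_trans [OF norm_ge_zero p [of 0]] by (simp add: zero_le_mult_iff)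
  have norm_exp: "norm (exp (of_real pi * \<i> * of_real (d n) * (2 ^ k * \<tau>))) = exp (- (pi * d n * Im \<tau> * 2 ^ k))" for n k
  proof -
    have "of_real pi * \<i> * of_real (d n) * (2 ^ k * \<tau>) = \<i> * (of_real (pi * d n * 2 ^ k) * \<tau>)"
      by simp
    then show ?thesis
      by (simp only: norm_exp_eq_Re) (simp add: mult_ac)
  qed
  have norm_c: "norm (c n) \<le> K * exp ((1 + 2 * pi * \<bar>Im z\<bar>) * \<bar>of_int n + a\<bar>)" for n
  proof -
    define t where "t = of_int n + a"
    have "of_int n + of_real a = complex_of_real t"
      by (simp add: t_def)
    then have "norm (exp (2 * of_real pi * \<i> * (of_int n + of_real a) * z)) = exp (2 * pi * - (Im z * t))"
      by (simp add: norm_exp_eq_Re mult_ac)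
    also have "\<dots> \<le> exp (2 * pi * (\<bar>Im z\<bar> * \<bar>t\<bar>))"
      by (intro iffD2 [OF exp_le_cancel_iff] mult_left_mono) (simp_all flip: abs_mult)
    finally have "norm (c n) \<le> (K * exp \<bar>t\<bar>) * exp (2 * pi * (\<bar>Im z\<bar> * \<bar>t\<bar>))"
      unfolding c_def norm_mult using p [of n] K by (intro mult_mono) (auto simp: t_def)
    also have "\<dots> = K * exp ((1 + 2 * pi * \<bar>Im z\<bar>) * \<bar>t\<bar>)"
      by (simp add: algebra_simps flip: exp_add)
    finally show ?thesis
      by (simp add: t_def)
  qed
  have bound: "norm (f n k) \<le> M n" for n k
  proof -
    have "pi * d n * Im \<tau> * 1 \<le> pi * d n * Im \<tau> * 2 ^ k"
      using d0 \<tau> by (intro mult_left_mono) auto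
    then have "norm (f n k) \<le> (K * exp ((1 + 2 * pi * \<bar>Im z\<bar>) * \<bar>of_int n + a\<bar>)) * exp (- (pi * d n * Im \<tau>))"
      unfolding f_def norm_mult norm_exp using norm_c K by (intro mult_mono) auto
    also have "\<dots> = M n"
      unfolding M_def d_def by (simp add: algebra_simps flip: exp_add)
    finally show ?thesis .
  qed
  have summable: "M summable_on UNIV"
    unfolding M_def using \<tau> by (intro summable_on_cmult_right gaussian_summable) simp
  have lim: "(\<lambda>k. f n k) \<longlonglongrightarrow> (if d n = 0 then c n else 0)" for n
  proof (cases "d n = 0")
    case False
    then have pos: "pi * d n * Im \<tau> > 0"
      using d0 [of n] \<tau> by simp
    have "(\<lambda>k. exp (- (r * 2 ^ k))) \<longlonglongrightarrow> 0" if "r > 0" for r :: real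
      using that by real_asymp
    from this [OF pos]
    have "(\<lambda>k. norm (c n) * exp (- (pi * d n * Im \<tau> * 2 ^ k))) \<longlonglongrightarrow> 0"
      by (rule tendsto_mult_right_zero)
    then have "(\<lambda>k. norm (f n k)) \<longlonglongrightarrow> 0"
      by (simp only: f_def norm_mult norm_exp)
    then show ?thesis
      using False by (simp add: tendsto_norm_zero_iff)
  qed (simp add: f_def)
  have "(\<lambda>k. \<Sum>\<^sub>\<infinity>n. f n k) \<longlonglongrightarrow> (\<Sum>\<^sub>\<infinity>n. if d n = 0 then c n else 0)"
    by (rule tendsto_infsum_dominated [OF lim bound summable]) simp
  also have "(\<lambda>k. \<Sum>\<^sub>\<infinity>n. f n k) = (\<lambda>k.
      exp (- (of_real pi * \<i> * (of_real m)\<^sup>2 * (2 ^ k * \<tau>))) * (\<Sum>\<^sub>\<infinity>n. p n * theta_term a z (2 ^ k * \<tau>) n))"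
    unfolding infsum_cmult_right' [symmetric]
  proof (intro ext infsum_cong)
    fix k n
    have "exp (2 * of_real pi * \<i> * (of_int n + of_real a) * z) * exp (of_real pi * \<i> * of_real (d n) * (2 ^ k * \<tau>))
      = exp (- (of_real pi * \<i> * (of_real m)\<^sup>2 * (2 ^ k * \<tau>))) * theta_term a z (2 ^ k * \<tau>) n"
      unfolding theta_term_def exp_add [symmetric] d_def
      by (rule arg_cong [where f = exp]) (simp add: power2_eq_square field_simps)
    then show "f n k = exp (- (of_real pi * \<i> * (of_real m)\<^sup>2 * (2 ^ k * \<tau>))) * (p n * theta_term a z (2 ^ k * \<tau>) n)"
      unfolding f_def c_def by (simp add: mult_ac)
  qed
  also have "(\<Sum>\<^sub>\<infinity>n. if d n = 0 then c n else 0) = (\<Sum>\<^sub>\<infinity>n\<in>{n. d n = 0}. c n)"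
    by (rule infsum_cong_neutral) auto
  also have "\<dots> = (\<Sum>n | d n = 0. c n)"
  proof (rule infsum_finite)
    \<comment> \<open>Summation over an infinite set would be zero by convention, so finiteness has to be established.\<close>
    have "n = \<lfloor>m - a\<rfloor> \<or> n = \<lfloor>- m - a\<rfloor>" if "d n = 0" for n
    proof -
      have "of_int n + a = m \<or> of_int n + a = - m"
        using that by (simp add: d_def power2_eq_iff)
      then have "m - a = of_int n \<or> - m - a = of_int n"
        by linarith
      then show ?thesis
        by (metis floor_of_int)
    qed
    then have "{n. d n = 0} \<subseteq> {\<lfloor>m - a\<rfloor>, \<lfloor>- m - a\<rfloor>}"
      by blast
    then show "finite {n. d n = 0}"
      by (rule finite_subset) simp
  qed
  finally show ?thesis
    by (simp add: d_def c_def)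
qed

section \<open>The Jacobi theta functions and their relations\<close>

text \<open>
  The four Jacobi theta functions for the lattice spanned by \<open>1\<close> and \<open>\<tau>\<close>. With this normalisation \<open>theta1\<close> is
  \<open>\<theta>[1,1]\<close>, the negative of the classical \<open>\<theta>\<^sub>1\<close>, which accounts for the sign in Jacobi's derivative formula below.
\<close>
definition theta1 :: "complex \<Rightarrow> complex \<Rightarrow> complex" where
  "theta1 z \<tau> = theta_series (1 / 2) (z + 1 / 2) \<tau>"

definition theta2 :: "complex \<Rightarrow> complex \<Rightarrow> complex" where
  "theta2 z \<tau> = theta_series (1 / 2) z \<tau>"

definition theta3 :: "complex \<Rightarrow> complex \<Rightarrow> complex" where
  "theta3 z \<tau> = theta_series 0 z \<tau>"

definition theta4 :: "complex \<Rightarrow> complex \<Rightarrow> complex" where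
  "theta4 z \<tau> = theta_series 0 (z + 1 / 2) \<tau>"

definition theta1_deriv :: "complex \<Rightarrow> complex \<Rightarrow> complex" where
  "theta1_deriv z \<tau> = theta_series_deriv (1 / 2) (z + 1 / 2) \<tau>"

definition theta4_deriv :: "complex \<Rightarrow> complex \<Rightarrow> complex" where
  "theta4_deriv z \<tau> = theta_series_deriv 0 (z + 1 / 2) \<tau>"

lemma exp_pi_i_half: "exp (2 * of_real pi * \<i> * (1 / 2)) = -1"
  by (simp add: exp_pi_i mult.commute)

lemma exp_pi_i_quarter: "exp (2 * of_real pi * \<i> * (1 / 4)) = \<i>"
proof -
  have "2 * of_real pi * \<i> * (1 / 4) = \<i> * of_real (pi / 2)"
    by simp
  then show ?thesis
    using cis_pi_half by (simp only: cis_conv_exp)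
qed

lemma theta_series_half_add_1: "theta_series (1 / 2) (z + 1) \<tau> = - theta_series (1 / 2) z \<tau>"
  using theta_series_add_1 [of "1 / 2" z \<tau>] exp_pi_i_half by simp

lemma theta_series_0_add_1: "theta_series 0 (z + 1) \<tau> = theta_series 0 z \<tau>"
  using theta_series_add_1 [of 0 z \<tau>] by simp

lemma theta_series_quarter_add_1: "theta_series (1 / 4) (z + 1) \<tau> = \<i> * theta_series (1 / 4) z \<tau>"
  using theta_series_add_1 [of "1 / 4" z \<tau>] exp_pi_i_quarter by simp

lemma theta_series_half_minus: "theta_series (1 / 2) (- z) \<tau> = theta_series (1 / 2) z \<tau>"
  using theta_series_minus [of "1 / 2" z \<tau>] theta_series_char_add_1 [of "- 1 / 2" "- z" \<tau>] by simp

lemma theta_series_three_quarters: "theta_series (1 / 4 + 1 / 2) z \<tau> = theta_series (1 / 4) (- z) \<tau>"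
  using theta_series_minus [of "1 / 4" "- z" \<tau>] theta_series_char_add_1 [of "- 1 / 4" z \<tau>] by simp

lemma theta1_minus: "theta1 (- z) \<tau> = - theta1 z \<tau>"
  using theta_series_half_minus [of "z - 1 / 2" \<tau>] theta_series_half_add_1 [of "z - 1 / 2" \<tau>]
  by (simp add: theta1_def add.commute)

lemma theta1_0 [simp]: "theta1 0 \<tau> = 0"
  using theta1_minus [of 0 \<tau>] by (simp add: eq_neg_iff_add_eq_0)

lemma theta4_minus: "theta4 (- z) \<tau> = theta4 z \<tau>"
  using theta_series_minus [of 0 "z - 1 / 2" \<tau>] theta_series_0_add_1 [of "z - 1 / 2" \<tau>]
  by (simp add: theta4_def add.commute)

lemma theta4_deriv_minus:
  assumes "Im \<tau> > 0"
  shows "theta4_deriv (- z) \<tau> = - theta4_deriv z \<tau>"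
  using theta_series_deriv_minus [OF assms, of 0 "z - 1 / 2"] theta_series_deriv_add_1 [OF assms, of 0 "z - 1 / 2"]
  by (simp add: theta4_deriv_def add.commute)

lemma theta4_deriv_0:
  assumes "Im \<tau> > 0"
  shows "theta4_deriv 0 \<tau> = 0"
  using theta4_deriv_minus [OF assms, of 0] by (simp add: eq_neg_iff_add_eq_0)

lemma theta1_has_field_derivative [derivative_intros]:
  assumes "(g has_field_derivative g') (at z)" "Im \<tau> > 0"
  shows "((\<lambda>z. theta1 (g z) \<tau>) has_field_derivative theta1_deriv (g z) \<tau> * g') (at z)"
  unfolding theta1_def theta1_deriv_def using assms by (auto intro!: derivative_eq_intros)

lemma theta4_has_field_derivative [derivative_intros]:
  assumes "(g has_field_derivative g') (at z)" "Im \<tau> > 0"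
  shows "((\<lambda>z. theta4 (g z) \<tau>) has_field_derivative theta4_deriv (g z) \<tau> * g') (at z)"
  unfolding theta4_def theta4_deriv_def using assms by (auto intro!: derivative_eq_intros)

text \<open>
  The characteristics \<open>1/4\<close> and \<open>3/4\<close> that occur here are exchanged by \<open>z \<mapsto> - z\<close>, so that a single theta
  function at \<open>2 \<tau>\<close> describes the product completely.
\<close>
lemma theta1_times_theta4:
  assumes "Im \<tau> > 0"
  shows "theta1 (z + w) \<tau> * theta4 (z - w) \<tau> =
      \<i> * (theta_series (1 / 4) (2 * z) (2 * \<tau>) * theta_series (1 / 4) (2 * w) (2 * \<tau>)
         - theta_series (1 / 4) (- (2 * z)) (2 * \<tau>) * theta_series (1 / 4) (- (2 * w)) (2 * \<tau>))"
proof -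
  have shift: "theta_series (1 / 4) (2 * (z + 1 / 2)) (2 * \<tau>) = \<i> * theta_series (1 / 4) (2 * z) (2 * \<tau>)"
    "theta_series (1 / 4) (- (2 * (z + 1 / 2))) (2 * \<tau>) = - \<i> * theta_series (1 / 4) (- (2 * z)) (2 * \<tau>)"
    using theta_series_quarter_add_1 [of "2 * z" "2 * \<tau>"]
      theta_series_quarter_add_1 [of "- (2 * z) - 1" "2 * \<tau>"] by (simp_all add: distrib_left)
  have "theta1 (z + w) \<tau> * theta4 (z - w) \<tau>
      = theta_series (1 / 4 + 1 / 4) ((z + 1 / 2) + w) \<tau> * theta_series (1 / 4 - 1 / 4) ((z + 1 / 2) - w) \<tau>"
    by (simp add: theta1_def theta4_def algebra_simps)
  then show ?thesis
    unfolding theta_series_mult [OF assms] theta_series_three_quarters shift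
    by (simp add: algebra_simps)
qed

lemma theta2_times_theta3:
  assumes "Im \<tau> > 0"
  shows "theta2 z \<tau> * theta3 z \<tau> =
      theta_series (1 / 4) 0 (2 * \<tau>) *
        (theta_series (1 / 4) (2 * z) (2 * \<tau>) + theta_series (1 / 4) (- (2 * z)) (2 * \<tau>))"
  using theta_series_mult [OF assms, of "1 / 4" "1 / 4" z 0] unfolding theta_series_three_quarters
  by (simp add: theta2_def theta3_def algebra_simps)

text \<open>
  The derivative of the elliptic function \<open>theta1 / theta4\<close>, that is, the formula for the derivative of \<open>sn\<close>. Differentiating
  \<open>theta1 (z + w) * theta4 (z - w)\<close> in \<open>w\<close> at \<open>0\<close> leaves the same combination of quarter-characteristic
  functions that factors as \<open>theta2 z * theta3 z\<close>; the constant is read off at \<open>z = 0\<close>.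
\<close>
lemma wronskian_theta1_theta4:
  assumes \<tau>: "Im \<tau> > 0"
  shows "(theta1_deriv z \<tau> * theta4 z \<tau> - theta1 z \<tau> * theta4_deriv z \<tau>) * (theta2 0 \<tau> * theta3 0 \<tau>)
    = theta1_deriv 0 \<tau> * theta4 0 \<tau> * (theta2 z \<tau> * theta3 z \<tau>)"
proof -
  define A where "A s = theta_series (1 / 4) s (2 * \<tau>)" for s
  define A' where "A' = theta_series_deriv (1 / 4) 0 (2 * \<tau>)"
  have W: "theta1_deriv z \<tau> * theta4 z \<tau> - theta1 z \<tau> * theta4_deriv z \<tau> = 2 * \<i> * A' * (A (2 * z) + A (- (2 * z)))" for z
  proof (rule DERIV_unique)
    have \<tau>2: "Im (2 * \<tau>) > 0"
      using \<tau> by simp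
    show "((\<lambda>w. theta1 (z + w) \<tau> * theta4 (z - w) \<tau>) has_field_derivative
         2 * \<i> * A' * (A (2 * z) + A (- (2 * z)))) (at 0)"
      unfolding theta1_times_theta4 [OF \<tau>] A_def A'_def
      by (rule derivative_eq_intros refl \<tau>2)+ (simp add: algebra_simps)
    show "((\<lambda>w. theta1 (z + w) \<tau> * theta4 (z - w) \<tau>) has_field_derivative
         theta1_deriv z \<tau> * theta4 z \<tau> - theta1 z \<tau> * theta4_deriv z \<tau>) (at 0)"
      by (rule derivative_eq_intros refl \<tau>)+ simp
  qed
  have "theta1_deriv 0 \<tau> * theta4 0 \<tau> = 4 * \<i> * A' * A 0"
    using W [of 0] by simp
  moreover have "theta2 z \<tau> * theta3 z \<tau> = A 0 * (A (2 * z) + A (- (2 * z)))"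
    and "theta2 0 \<tau> * theta3 0 \<tau> = 2 * A 0 * A 0"
    using theta2_times_theta3 [OF \<tau>, of z] theta2_times_theta3 [OF \<tau>, of 0] by (simp_all add: A_def)
  ultimately show ?thesis
    by (simp only: W) simp
qed

text \<open>
  Over \<open>2 \<tau>\<close> the squares of \<open>theta4\<close> and \<open>theta1\<close> are linear in \<open>(F, G)\<close>, with the same coefficients
  \<open>F 0\<close> and \<open>G 0\<close> in exchanged roles. The difference of products on the right therefore factors as
  \<open>((F 0)\<^sup>2 - (G 0)\<^sup>2) * (F x * F y - G x * G y)\<close>, and its first factor is \<open>(theta4 0 \<tau>)\<^sup>2\<close>.
\<close>
lemma theta4_addition:
  assumes \<tau>: "Im \<tau> > 0"
  shows "theta4 (x + y) \<tau> * theta4 (x - y) \<tau> * (theta4 0 \<tau>)\<^sup>2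
       = (theta4 x \<tau>)\<^sup>2 * (theta4 y \<tau>)\<^sup>2 - (theta1 x \<tau>)\<^sup>2 * (theta1 y \<tau>)\<^sup>2"
proof -
  define F where "F s = theta_series 0 (2 * s) (2 * \<tau>)" for s
  define G where "G s = theta_series (1 / 2) (2 * s) (2 * \<tau>)" for s
  have shift: "theta_series 0 (2 * (s + 1 / 2)) (2 * \<tau>) = F s" 
    "theta_series (1 / 2) (2 * (s + 1 / 2)) (2 * \<tau>) = - G s" for s
    using theta_series_0_add_1 [of "2 * s" "2 * \<tau>"] theta_series_half_add_1 [of "2 * s" "2 * \<tau>"]
    by (simp_all add: F_def G_def distrib_left)
  have 1: "theta4 (x + y) \<tau> * theta4 (x - y) \<tau> = F x * F y - G x * G y" for x y
  proof -
    have "theta4 (x + y) \<tau> * theta4 (x - y) \<tau>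
        = theta_series (0 + 0) ((x + 1 / 2) + y) \<tau> * theta_series (0 - 0) ((x + 1 / 2) - y) \<tau>"
      by (simp add: theta4_def algebra_simps)
    also have "\<dots> = F x * F y - G x * G y"
      unfolding theta_series_mult [OF \<tau>] unfolding shift add_0 by (simp add: F_def G_def)
    finally show ?thesis .
  qed
  have 2: "(theta4 x \<tau>)\<^sup>2 = F x * F 0 - G x * G 0" for x
    using 1 [of x 0] by (simp add: power2_eq_square)
  have 3: "(theta1 x \<tau>)\<^sup>2 = F x * G 0 - G x * F 0" for x
    using theta_series_mult [OF \<tau>, of "1 / 2" 0 "x + 1 / 2" 0] unfolding shift
    using theta_series_char_add_1 [of 0 "2 * (x + 1 / 2)" "2 * \<tau>"] shift
    by (simp add: theta1_def power2_eq_square F_def [symmetric] G_def [symmetric])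
       (simp add: F_def G_def)
  show ?thesis
    unfolding 1 2 3 by (simp add: algebra_simps)
qed

text \<open>
  In the multiplication formula the second product contains \<open>theta1 0 = 0\<close>, so only one product survives.
\<close>
lemma theta_series_duplication:
  assumes "Im \<tau> > 0"
  shows "theta_series a z \<tau> * theta_series a (z + 1 / 2) \<tau> = theta4 0 (2 * \<tau>) * theta_series a (2 * z + 1 / 2) (2 * \<tau>)"
  using theta_series_mult [OF assms, of a 0 "z + 1 / 4" "1 / 4"] theta1_0 [of "2 * \<tau>"]
  by (simp add: theta4_def theta1_def algebra_simps)

lemma theta1_theta2_duplication:
  assumes "Im \<tau> > 0"
  shows "theta1 z \<tau> * theta2 z \<tau> = theta4 0 (2 * \<tau>) * theta1 (2 * z) (2 * \<tau>)"
  using theta_series_duplication [OF assms, of "1 / 2" z] by (simp add: theta1_def theta2_def mult.commute)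

lemma theta3_theta4_duplication:
  assumes "Im \<tau> > 0"
  shows "theta3 z \<tau> * theta4 z \<tau> = theta4 0 (2 * \<tau>) * theta4 (2 * z) (2 * \<tau>)"
  using theta_series_duplication [OF assms, of 0 z] by (simp add: theta3_def theta4_def)

lemma theta1_times_theta2_0:
  assumes "Im \<tau> > 0"
  shows "theta1 z \<tau> * theta2 0 \<tau> = 2 * theta1 z (2 * \<tau>) * theta4 z (2 * \<tau>)"
  using theta_series_mult [OF assms, of "1 / 2" 0 "z / 2 + 1 / 4" "z / 2 + 1 / 4"] theta_series_char_add_1 [of 0]
  by (simp add: theta1_def theta2_def theta4_def distrib_left)

lemma theta2_0_squared:
  assumes "Im \<tau> > 0"
  shows "(theta2 0 \<tau>)\<^sup>2 = 2 * theta2 0 (2 * \<tau>) * theta3 0 (2 * \<tau>)"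
  using theta_series_mult [OF assms, of "1 / 2" 0 0 0] theta_series_char_add_1 [of 0]
  by (simp add: theta2_def theta3_def power2_eq_square)

text \<open>
  The products \<open>theta1 * theta2\<close> and \<open>theta3 * theta4\<close> double the argument and \<open>\<tau>\<close> together;
  \<open>theta1_times_theta2_0\<close> then returns from \<open>2 \<tau>\<close> to \<open>\<tau>\<close>.
\<close>
lemma theta1_double_argument:
  assumes \<tau>: "Im \<tau> > 0"
  shows "theta1 (2 * z) \<tau> * (theta2 0 \<tau> * theta3 0 \<tau> * theta4 0 \<tau>)
       = 2 * theta1 z \<tau> * theta2 z \<tau> * theta3 z \<tau> * theta4 z \<tau>"
proof -
  have "theta1 (2 * z) \<tau> * theta2 0 \<tau> * (theta3 0 \<tau> * theta4 0 \<tau>)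
      = 2 * (theta4 0 (2 * \<tau>) * theta1 (2 * z) (2 * \<tau>)) * (theta4 0 (2 * \<tau>) * theta4 (2 * z) (2 * \<tau>))"
    unfolding theta1_times_theta2_0 [OF \<tau>] theta3_theta4_duplication [OF \<tau>, of 0] by simp
  also have "\<dots> = 2 * (theta1 z \<tau> * theta2 z \<tau>) * (theta3 z \<tau> * theta4 z \<tau>)"
    unfolding theta1_theta2_duplication [OF \<tau>] theta3_theta4_duplication [OF \<tau>] ..
  finally show ?thesis
    by (simp add: mult.assoc)
qed

section \<open>Nonvanishing and the derivative formula of Jacobi\<close>

text \<open>
  The nonvanishing statements below rest on this: a zero that persists along \<open>2 ^ k * \<tau>\<close> contradicts a
  nonzero leading term.
\<close>
lemma doubling_zero_propagates:
  assumes "\<And>\<tau>. Im \<tau> > 0 \<Longrightarrow> f \<tau> = 0 \<Longrightarrow> f (2 * \<tau>) = (0 :: complex)" and "Im \<tau> > 0" "f \<tau> = 0"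
  shows "f (2 ^ k * \<tau>) = 0"
proof (induction k)
  case (Suc k)
  then show ?case
    using assms(1) [of "2 ^ k * \<tau>"] assms(2)
    by (simp add: Im_power_real mult.assoc)
qed (use assms in simp)

lemma theta_series_leading_term:
  assumes "Im \<tau> > 0" "\<bar>a\<bar> < 1 / 2"
  shows "(\<lambda>k. exp (- (of_real pi * \<i> * (of_real a)\<^sup>2 * (2 ^ k * \<tau>))) * theta_series a z (2 ^ k * \<tau>))
            \<longlonglongrightarrow> exp (2 * of_real pi * \<i> * of_real a * z)"
proof -
  have dist: "a\<^sup>2 < (of_int n + a)\<^sup>2" if "n \<noteq> 0" for n
  proof -
    have "\<bar>a\<bar> < \<bar>of_int n + a\<bar>"
      using assms(2) that by linarith
    then show ?thesis
      by (metis abs_ge_zero power2_abs power2_strict_mono abs_le_square_iff linorder_not_le)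
  qed
  then have least: "a\<^sup>2 \<le> (of_int n + a)\<^sup>2" for n
    by (cases "n = 0") (auto intro: less_imp_le)
  have "{n. (of_int n + a)\<^sup>2 = a\<^sup>2} = {0}"
    using dist by force
  then show ?thesis
    using theta_leading_term [OF assms(1) least, where p = "\<lambda>_. 1" and K = 1] by (simp add: theta_series_def)
qed

lemma theta_series_half_leading_index:
  shows "(1 / 2)\<^sup>2 \<le> (real_of_int n + 1 / 2)\<^sup>2" "{n. (real_of_int n + 1 / 2)\<^sup>2 = (1 / 2)\<^sup>2} = {0, -1}"
proof -
  have *: "(real_of_int n + 1 / 2)\<^sup>2 - (1 / 2)\<^sup>2 = of_int (n * (n + 1))" for n
    by (simp add: power2_eq_square algebra_simps)
  have "n * (n + 1) \<ge> 0"
    by (cases "n \<ge> 0") (auto simp: mult_nonneg_nonneg mult_nonpos_nonpos)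
  then show "(1 / 2)\<^sup>2 \<le> (real_of_int n + 1 / 2)\<^sup>2"
    using * [of n] by (metis diff_ge_0_iff_ge of_int_0_le_iff)
  have "(real_of_int n + 1 / 2)\<^sup>2 = (1 / 2)\<^sup>2 \<longleftrightarrow> n * (n + 1) = 0" for n
    using * [of n] by (metis eq_iff_diff_eq_0 of_int_eq_0_iff)
  then have "{n. (real_of_int n + 1 / 2)\<^sup>2 = (1 / 2)\<^sup>2} = {n. n * (n + 1) = 0}"
    by (simp only:)
  also have "\<dots> = {0, -1}"
    by auto
  finally show "{n. (real_of_int n + 1 / 2)\<^sup>2 = (1 / 2)\<^sup>2} = {0, -1}" .
qed

lemma theta2_leading_term:
  assumes "Im \<tau> > 0"
  shows "(\<lambda>k. exp (- (of_real pi * \<i> * (of_real (1 / 2))\<^sup>2 * (2 ^ k * \<tau>))) * theta2 0 (2 ^ k * \<tau>)) \<longlonglongrightarrow> 2"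
  using theta_leading_term [OF assms theta_series_half_leading_index(1), where p = "\<lambda>_. 1" and K = 1 and z = 0]
  by (simp add: theta2_def theta_series_def theta_series_half_leading_index(2))

text \<open>
  The indices \<open>0\<close> and \<open>-1\<close> contribute \<open>\<pi> \<i> * \<i>\<close> and \<open>(- \<pi> \<i>) * (- \<i>)\<close>.
\<close>
lemma theta1_deriv_leading_term:
  assumes "Im \<tau> > 0"
  shows "(\<lambda>k. exp (- (of_real pi * \<i> * (of_real (1 / 2))\<^sup>2 * (2 ^ k * \<tau>))) * theta1_deriv 0 (2 ^ k * \<tau>)) \<longlonglongrightarrow> - 2 * of_real pi"
proof -
  define p where "p n = 2 * of_real pi * \<i> * (of_int n + of_real (1 / 2))" for n
  have "norm (p n) \<le> 2 * pi * exp \<bar>of_int n + 1 / 2\<bar>" for n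
  proof -
    define t where "t = \<bar>of_int n + 1 / 2 :: real\<bar>"
    have "of_int n + of_real (1 / 2) = complex_of_real (of_int n + 1 / 2)"
      by simp
    then have "norm (p n) = 2 * pi * t"
      unfolding p_def t_def by (simp only: norm_mult norm_of_real) simp
    moreover have "t \<le> exp t"
      using exp_ge_add_one_self [of t] by linarith
    ultimately show ?thesis
      by (simp add: t_def)
  qed
  note lim = theta_leading_term [OF assms theta_series_half_leading_index(1), where p = p and K = "2 * pi" and z = "1 / 2", OF this]
  have "(\<Sum>n | (real_of_int n + 1 / 2)\<^sup>2 = (1 / 2)\<^sup>2. p n * exp (2 * of_real pi * \<i> * (of_int n + of_real (1 / 2)) * (1 / 2)))
      = - 2 * of_real pi"
  proof -
    have "exp (2 * of_real pi * \<i> * (of_int 0 + of_real (1 / 2)) * (1 / 2)) = \<i>"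
      using exp_pi_i_quarter by (simp add: mult_ac)
    moreover have "exp (2 * of_real pi * \<i> * (of_int (- 1) + of_real (1 / 2)) * (1 / 2)) = - \<i>"
      using exp_pi_i_quarter exp_minus [of "2 * of_real pi * \<i> * (1 / 4)"] by (simp add: mult_ac)
    ultimately show ?thesis
      unfolding theta_series_half_leading_index(2) by (simp add: p_def)
  qed
  then show ?thesis
    using lim by (simp add: theta1_deriv_def theta_series_deriv_def p_def)
qed

lemma theta4_0_nonzero:
  assumes "Im \<tau> > 0"
  shows "theta4 0 \<tau> \<noteq> 0"
proof
  assume "theta4 0 \<tau> = 0"
  moreover have "theta4 0 (2 * \<tau>) = 0" if "Im \<tau> > 0" "theta4 0 \<tau> = 0" for \<tau>
    using theta3_theta4_duplication [OF that(1), of 0] that(2) by simp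
  ultimately have "theta4 0 (2 ^ k * \<tau>) = 0" for k
    using assms by (intro doubling_zero_propagates [of "theta4 0"])
  then show False
    using theta_series_leading_term [OF assms, of 0 "1 / 2"] by (simp add: theta4_def LIMSEQ_const_iff)
qed

text \<open>
  The bound on \<open>a\<close> makes the index \<open>0\<close> the unique minimum of \<open>(n + a)\<^sup>2\<close>, so that the leading terms
  cannot cancel; at \<open>a = 1/2\<close> the terms of index \<open>0\<close> and \<open>-1\<close> do cancel, in accordance with \<open>theta1 0 = 0\<close>.
\<close>
lemma theta_series_at_half_nonzero:
  assumes "Im \<tau> > 0" "\<bar>a\<bar> < 1 / 2"
  shows "theta_series a (1 / 2) \<tau> \<noteq> 0"
proof
  assume "theta_series a (1 / 2) \<tau> = 0"
  moreover have "theta_series a (1 / 2) (2 * \<tau>) = 0" if "Im \<tau> > 0" "theta_series a (1 / 2) \<tau> = 0" for \<tau>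
    using theta_series_duplication [OF that(1), of a 0] theta4_0_nonzero [of "2 * \<tau>"] that by simp
  ultimately have "theta_series a (1 / 2) (2 ^ k * \<tau>) = 0" for k
    using assms(1) by (intro doubling_zero_propagates [of "theta_series a (1 / 2)"])
  then show False
    using theta_series_leading_term [OF assms, of "1 / 2"] by (simp add: LIMSEQ_const_iff)
qed

lemma theta3_0_nonzero:
  assumes "Im \<tau> > 0"
  shows "theta3 0 \<tau> \<noteq> 0"
  using theta3_theta4_duplication [OF assms, of 0] theta4_0_nonzero [of "2 * \<tau>"] assms by auto

lemma theta1_deriv_duplication:
  assumes \<tau>: "Im \<tau> > 0"
  shows "theta1_deriv 0 \<tau> * theta2 0 \<tau> = 2 * theta4 0 (2 * \<tau>) * theta1_deriv 0 (2 * \<tau>)"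
proof (rule DERIV_unique)
  have \<tau>2: "Im (2 * \<tau>) > 0"
    using \<tau> by simp
  show "((\<lambda>z. theta1 z \<tau> * theta2 z \<tau>) has_field_derivative theta1_deriv 0 \<tau> * theta2 0 \<tau>) (at 0)"
    unfolding theta2_def by (rule derivative_eq_intros refl \<tau>)+ simp
  show "((\<lambda>z. theta1 z \<tau> * theta2 z \<tau>) has_field_derivative 2 * theta4 0 (2 * \<tau>) * theta1_deriv 0 (2 * \<tau>)) (at 0)"
    unfolding theta1_theta2_duplication [OF \<tau>] by (rule derivative_eq_intros refl \<tau>2)+ simp
qed

lemma theta1_deriv_0_nonzero:
  assumes "Im \<tau> > 0"
  shows "theta1_deriv 0 \<tau> \<noteq> 0"
proof
  assume "theta1_deriv 0 \<tau> = 0"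
  moreover have "theta1_deriv 0 (2 * \<tau>) = 0" if "Im \<tau> > 0" "theta1_deriv 0 \<tau> = 0" for \<tau>
    using theta1_deriv_duplication [OF that(1)] theta4_0_nonzero [of "2 * \<tau>"] that by simp
  ultimately have "theta1_deriv 0 (2 ^ k * \<tau>) = 0" for k
    using assms by (intro doubling_zero_propagates [of "theta1_deriv 0"])
  then show False
    using theta1_deriv_leading_term [OF assms] by (simp add: LIMSEQ_const_iff)
qed

lemma theta2_0_nonzero:
  assumes "Im \<tau> > 0"
  shows "theta2 0 \<tau> \<noteq> 0"
  using theta1_deriv_duplication [OF assms] theta1_deriv_0_nonzero [of "2 * \<tau>"] theta4_0_nonzero [of "2 * \<tau>"] assms
  by auto

text \<open>
  The quotient \<open>R\<close> of \<open>theta1_deriv 0\<close> by \<open>theta2 0 * theta3 0 * theta4 0\<close> is invariant under \<open>\<tau> \<mapsto> 2 \<tau>\<close> by the duplication formulas; it is therefore equal to its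
  limit along \<open>2 ^ k * \<tau>\<close>, which the leading terms determine.
\<close>
lemma jacobi_derivative_formula:
  assumes "Im \<tau> > 0"
  shows "theta1_deriv 0 \<tau> = - of_real pi * theta2 0 \<tau> * theta3 0 \<tau> * theta4 0 \<tau>"
proof -
  define R where "R \<tau> = theta1_deriv 0 \<tau> / (theta2 0 \<tau> * theta3 0 \<tau> * theta4 0 \<tau>)" for \<tau>
  note nz = theta2_0_nonzero theta3_0_nonzero theta4_0_nonzero
  have R2: "R (2 * \<tau>) = R \<tau>" if \<tau>: "Im \<tau> > 0" for \<tau>
  proof -
    have \<tau>2: "Im (2 * \<tau>) > 0"
      using \<tau> by simp
    have "R \<tau> = theta1_deriv 0 \<tau> * theta2 0 \<tau> / ((theta2 0 \<tau>)\<^sup>2 * (theta3 0 \<tau> * theta4 0 \<tau>))"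
      using nz [OF \<tau>] by (simp add: R_def power2_eq_square divide_simps)
    also have "\<dots> = R (2 * \<tau>)"
      unfolding theta1_deriv_duplication [OF \<tau>] theta2_0_squared [OF \<tau>] theta3_theta4_duplication [OF \<tau>]
      using nz [OF \<tau>2] by (simp add: R_def divide_simps)
    finally show ?thesis ..
  qed
  have R: "R (2 ^ k * \<tau>) = R \<tau>" for k
  proof (induction k)
    case (Suc k)
    have "Im (2 ^ k * \<tau>) > 0"
      using assms by (simp add: Im_power_real)
    from R2 [OF this] Suc show ?case
      by (simp add: mult.assoc)
  qed simp
  define e where "e k = exp (- (of_real pi * \<i> * (of_real (1 / 2))\<^sup>2 * (2 ^ k * \<tau>)))" for k :: nat
  have "(\<lambda>k. theta3 0 (2 ^ k * \<tau>)) \<longlonglongrightarrow> 1" "(\<lambda>k. theta4 0 (2 ^ k * \<tau>)) \<longlonglongrightarrow> 1"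
    using theta_series_leading_term [OF assms, of 0] by (simp_all add: theta3_def theta4_def)
  then have "(\<lambda>k. (e k * theta1_deriv 0 (2 ^ k * \<tau>)) /
      ((e k * theta2 0 (2 ^ k * \<tau>)) * theta3 0 (2 ^ k * \<tau>) * theta4 0 (2 ^ k * \<tau>))) \<longlonglongrightarrow> - 2 * of_real pi / (2 * 1 * 1)"
    unfolding e_def
    by (intro tendsto_intros theta1_deriv_leading_term theta2_leading_term assms) auto
  also have "(\<lambda>k. (e k * theta1_deriv 0 (2 ^ k * \<tau>)) /
      ((e k * theta2 0 (2 ^ k * \<tau>)) * theta3 0 (2 ^ k * \<tau>) * theta4 0 (2 ^ k * \<tau>))) = (\<lambda>k. R (2 ^ k * \<tau>))"
    by (simp add: R_def e_def mult.assoc)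
  also have "\<dots> = (\<lambda>k. R \<tau>)"
    by (simp only: R)
  finally have "R \<tau> = - of_real pi"
    by (simp add: LIMSEQ_const_iff)
  then show ?thesis
    using nz [OF assms] by (simp add: R_def divide_simps mult_ac)
qed

section \<open>Logarithmic derivatives at points of order three\<close>

text \<open>
  Special case of a translation by a full \<open>\<tau>\<close>: the characteristic increases by 1 and thus returns to itself. Because
  \<open>theta1\<close> and \<open>theta4\<close> have the same multiplier, their quotient has period \<open>\<tau>\<close>.
\<close>
lemma quasi_period:
  fixes z \<tau> :: complex
  defines "q \<equiv> - exp (2 * of_real pi * \<i> * (\<tau> / 2 + z))"
  shows theta1_quasi_period: "theta1 z \<tau> = q * theta1 (z + \<tau>) \<tau>"
    and theta4_quasi_period: "theta4 z \<tau> = q * theta4 (z + \<tau>) \<tau>"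
    and theta4_deriv_quasi_period: "Im \<tau> > 0 \<Longrightarrow>
      theta4_deriv z \<tau> = q * (theta4_deriv (z + \<tau>) \<tau> + 2 * of_real pi * \<i> * theta4 (z + \<tau>) \<tau>)"
proof -
  have q: "exp (2 * of_real pi * \<i> * (1 / 2 * (of_real 1)\<^sup>2 * \<tau> + of_real 1 * (z + 1 / 2))) = q"
  proof -
    have "2 * of_real pi * \<i> * (1 / 2 * (of_real 1)\<^sup>2 * \<tau> + of_real 1 * (z + 1 / 2))
        = 2 * of_real pi * \<i> * (\<tau> / 2 + z) + 2 * of_real pi * \<i> * (1 / 2)"
      by (simp add: algebra_simps)
    then show ?thesis
      unfolding q_def by (simp only: exp_add exp_pi_i_half mult_minus1_right)
  qed
  have swap: "z + 1 / 2 + of_real 1 * \<tau> = z + \<tau> + 1 / 2"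
    by simp
  show "theta1 z \<tau> = q * theta1 (z + \<tau>) \<tau>"
    using theta_series_char_add [of "1 / 2" 1 "z + 1 / 2" \<tau>] theta_series_char_add_1 [of "1 / 2"]
    unfolding q swap by (simp add: theta1_def)
  show "theta4 z \<tau> = q * theta4 (z + \<tau>) \<tau>"
    using theta_series_char_add [of 0 1 "z + 1 / 2" \<tau>] theta_series_char_add_1 [of 0]
    unfolding q swap by (simp add: theta4_def)
  assume \<tau>: "Im \<tau> > 0"
  have "theta_series_deriv (0 + 1) w \<tau> = theta_series_deriv 0 w \<tau>" for w
    using theta_series_has_field_derivative [OF \<tau>, of "0 + 1"] unfolding theta_series_char_add_1
    by (rule DERIV_unique) (rule theta_series_has_field_derivative [OF \<tau>])
  then show "theta4_deriv z \<tau> = q * (theta4_deriv (z + \<tau>) \<tau> + 2 * of_real pi * \<i> * theta4 (z + \<tau>) \<tau>)"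
    using theta_series_deriv_char_add [OF \<tau>, of 0 1 "z + 1 / 2"] unfolding q swap
    by (simp add: theta4_deriv_def theta4_def)
qed

text \<open>
  Differentiation of the addition formula in \<open>y\<close> at \<open>x = y = z\<close>; the second factor of the left-hand side contributes
  nothing because \<open>theta4\<close> is even.
\<close>
lemma theta4_deriv_double_argument:
  assumes \<tau>: "Im \<tau> > 0"
  shows "theta4_deriv (2 * z) \<tau> * theta4 0 \<tau> ^ 3
       = 2 * (theta4 z \<tau> ^ 3 * theta4_deriv z \<tau> - theta1 z \<tau> ^ 3 * theta1_deriv z \<tau>)"
proof (rule DERIV_unique)
  show "((\<lambda>y. theta4 (z + y) \<tau> * theta4 (z - y) \<tau> * (theta4 0 \<tau>)\<^sup>2) has_field_derivative
      theta4_deriv (2 * z) \<tau> * theta4 0 \<tau> ^ 3) (at z)"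
    by (rule derivative_eq_intros refl \<tau>)+
       (simp add: theta4_deriv_0 [OF \<tau>] power2_eq_square power3_eq_cube mult_ac flip: mult_2)
  show "((\<lambda>y. theta4 (z + y) \<tau> * theta4 (z - y) \<tau> * (theta4 0 \<tau>)\<^sup>2) has_field_derivative
      2 * (theta4 z \<tau> ^ 3 * theta4_deriv z \<tau> - theta1 z \<tau> ^ 3 * theta1_deriv z \<tau>)) (at z)"
    unfolding theta4_addition [OF \<tau>]
    by (rule derivative_eq_intros refl \<tau>)+
       (simp add: power2_eq_square power3_eq_cube algebra_simps)
qed

lemma theta4_double_argument:
  assumes \<tau>: "Im \<tau> > 0"
  shows "theta4 (2 * z) \<tau> * theta4 0 \<tau> ^ 3 = theta4 z \<tau> ^ 4 - theta1 z \<tau> ^ 4"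
  using theta4_addition [OF \<tau>, of z z] by (simp add: power2_eq_square power3_eq_cube power4_eq_xxxx mult_ac flip: mult_2)

text \<open>
  The duplication formula \<open>Z(2z) = 2 Z(z) - k\<^sup>2 sn(z)\<^sup>2 sn(2z)\<close> for Jacobi's zeta function \<open>Z = theta4' / theta4\<close>, written
  with theta functions. The Wronskian eliminates the derivative of \<open>theta1\<close>, and the product
  \<open>theta1 * theta2 * theta3 * theta4\<close> that arises is a multiple of \<open>theta1 (2 * z)\<close>.
\<close>
lemma theta4_log_deriv_double_argument:
  assumes \<tau>: "Im \<tau> > 0" and nz: "theta4 z \<tau> \<noteq> 0" "theta4 (2 * z) \<tau> \<noteq> 0"
  shows "theta4_deriv (2 * z) \<tau> / theta4 (2 * z) \<tau> = 2 * (theta4_deriv z \<tau> / theta4 z \<tau>)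
    - theta1_deriv 0 \<tau> / theta4 0 \<tau> * (theta1 z \<tau> / theta4 z \<tau>)\<^sup>2 * (theta1 (2 * z) \<tau> / theta4 (2 * z) \<tau>)"
proof -
  define T2 T3 T4 D where "T2 = theta2 0 \<tau>" and "T3 = theta3 0 \<tau>" and "T4 = theta4 0 \<tau>" and "D = theta1_deriv 0 \<tau>"
  define s1 s2 s3 s4 d1 d4 where "s1 = theta1 z \<tau>" and "s2 = theta2 z \<tau>" and "s3 = theta3 z \<tau>" and "s4 = theta4 z \<tau>"
    and "d1 = theta1_deriv z \<tau>" and "d4 = theta4_deriv z \<tau>"
  define u1 u4 v4 where "u1 = theta1 (2 * z) \<tau>" and "u4 = theta4 (2 * z) \<tau>" and "v4 = theta4_deriv (2 * z) \<tau>"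
  have T: "T2 \<noteq> 0" "T3 \<noteq> 0" "T4 \<noteq> 0" and s4: "s4 \<noteq> 0" and u4: "u4 \<noteq> 0"
    using theta2_0_nonzero theta3_0_nonzero theta4_0_nonzero \<tau> nz by (simp_all add: T2_def T3_def T4_def s4_def u4_def)
  have wronskian: "(d1 * s4 - s1 * d4) * (T2 * T3) = D * T4 * (s2 * s3)"
    using wronskian_theta1_theta4 [OF \<tau>, of z]
    by (simp add: T2_def T3_def T4_def D_def s1_def s2_def s3_def s4_def d1_def d4_def)
  have double: "v4 * T4 ^ 3 = 2 * (s4 ^ 3 * d4 - s1 ^ 3 * d1)" "u4 * T4 ^ 3 = s4 ^ 4 - s1 ^ 4"
     "u1 * (T2 * T3 * T4) = 2 * s1 * s2 * s3 * s4"
    using theta4_deriv_double_argument [OF \<tau>, of z] theta4_double_argument [OF \<tau>, of z] theta1_double_argument [OF \<tau>, of z]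
    by (simp_all add: T2_def T3_def T4_def s1_def s2_def s3_def s4_def d1_def d4_def u1_def u4_def v4_def)
  \<comment> \<open>The common factor is the one with which the goal lies in the ideal of the four relations above.\<close>
  have "T4\<^sup>2 * T2 * T3 * s4 * (v4 * T4 * s4\<^sup>2) = T4\<^sup>2 * T2 * T3 * s4 * (2 * d4 * s4 * u4 * T4 - D * s1\<^sup>2 * u1)"
    using wronskian double by algebra
  then have "v4 * T4 * s4\<^sup>2 = 2 * d4 * s4 * u4 * T4 - D * s1\<^sup>2 * u1"
    using T s4 by simp
  then have "v4 / u4 = 2 * (d4 / s4) - D / T4 * (s1 / s4)\<^sup>2 * (u1 / u4)"
    using T s4 u4 by (simp add: field_simps power2_eq_square power3_eq_cube)
  then show ?thesis
    by (simp add: T4_def D_def s1_def s4_def d4_def u1_def u4_def v4_def)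
qed

section \<open>Theta constants with fractional characteristics\<close>

lemma theta_char_eq_theta_series: "theta_char \<epsilon> \<epsilon>' \<zeta> \<tau> = theta_series (\<epsilon> / 2) (\<zeta> + of_real (\<epsilon>' / 2)) \<tau>"
  unfolding theta_char_def theta_series_def theta_term_def by simp

lemma theta_deriv_const_eq_theta_series_deriv:
  assumes "Im \<tau> > 0"
  shows "theta_deriv_const \<epsilon> \<epsilon>' \<tau> = theta_series_deriv (\<epsilon> / 2) (of_real (\<epsilon>' / 2)) \<tau>"
proof -
  have "((\<lambda>\<zeta>. theta_char \<epsilon> \<epsilon>' \<zeta> \<tau>) has_field_derivative theta_series_deriv (\<epsilon> / 2) (of_real (\<epsilon>' / 2)) \<tau>) (at 0)"
    unfolding theta_char_eq_theta_series by (rule derivative_eq_intros refl assms)+ simp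
  then show ?thesis
    unfolding theta_deriv_const_def by (rule DERIV_imp_deriv)
qed

text \<open>
  The characteristic \<open>1/3\<close> is \<open>1 - 2/3\<close>, so at the lower characteristic 1 it belongs to \<open>theta1\<close> at \<open>- \<tau>/3\<close>; the
  characteristic \<open>2/3\<close> belongs to \<open>theta4\<close> at \<open>\<tau>/3\<close>, and evenness moves it to the same point. The factor \<open>h\<close> is a sixth
  root of unity, which disappears in the cube of a quotient.
\<close>
lemma theta_const_third_characteristics:
  fixes \<tau> :: complex
  defines "u \<equiv> - \<tau> / 3" and "k \<equiv> exp (2 * of_real pi * \<i> * (\<tau> / 18))" and "h \<equiv> exp (2 * of_real pi * \<i> * (1 / 6))"
  shows "theta_const (1/3) 1 \<tau> = k / h * theta1 u \<tau>"
    and "theta_const (2/3) 1 \<tau> = k * h * theta4 u \<tau>"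
    and "theta_const (1/3) 0 \<tau> = k * theta2 u \<tau>"
    and "theta_const (2/3) 0 \<tau> = k * theta3 u \<tau>"
    and "Im \<tau> > 0 \<Longrightarrow> theta_deriv_const (1/3) 1 \<tau> = k / h * (theta1_deriv u \<tau> - 2 * of_real pi * \<i> / 3 * theta1 u \<tau>)"
proof -
  have k1: "exp (2 * of_real pi * \<i> * (1 / 2 * (of_real (- 1 / 3))\<^sup>2 * \<tau> + of_real (- 1 / 3) * (1 / 2))) = k / h"
    unfolding k_def h_def exp_diff [symmetric]
    by (rule arg_cong [where f = exp]) (simp add: power2_eq_square field_simps)
  have k2: "exp (2 * of_real pi * \<i> * (1 / 2 * (of_real (1 / 3))\<^sup>2 * \<tau> + of_real (1 / 3) * (1 / 2))) = k * h"
    unfolding k_def h_def exp_add [symmetric]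
    by (rule arg_cong [where f = exp]) (simp add: power2_eq_square field_simps)
  have k3: "exp (2 * of_real pi * \<i> * (1 / 2 * (of_real (- 1 / 3))\<^sup>2 * \<tau> + of_real (- 1 / 3) * 0)) = k"
      "exp (2 * of_real pi * \<i> * (1 / 2 * (of_real (1 / 3))\<^sup>2 * \<tau> + of_real (1 / 3) * 0)) = k"
    unfolding k_def by (simp_all add: power2_eq_square)
  have sixth: "1 / 2 + (- 1 / 3) = (1 / 6 :: real)"
    by simp
  have shift: "1 / 2 + of_real (- 1 / 3) * \<tau> = u + 1 / 2" "1 / 2 + of_real (1 / 3) * \<tau> = - u + 1 / 2"
      "0 + of_real (- 1 / 3) * \<tau> = u" "0 + of_real (1 / 3) * \<tau> = - u"
    by (simp_all add: u_def)
  show "theta_const (1/3) 1 \<tau> = k / h * theta1 u \<tau>"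
    using theta_series_char_add [of "1 / 2" "- 1 / 3" "1 / 2" \<tau>] unfolding k1 shift sixth
    by (simp add: theta_const_def theta_char_eq_theta_series theta1_def)
  show "theta_const (2/3) 1 \<tau> = k * h * theta4 u \<tau>"
    using theta_series_char_add [of 0 "1 / 3" "1 / 2" \<tau>] theta4_minus [of u \<tau>] unfolding k2 shift
    by (simp add: theta_const_def theta_char_eq_theta_series theta4_def)
  show "theta_const (1/3) 0 \<tau> = k * theta2 u \<tau>"
    using theta_series_char_add [of "1 / 2" "- 1 / 3" 0 \<tau>] unfolding k3 shift sixth
    by (simp add: theta_const_def theta_char_eq_theta_series theta2_def)
  show "theta_const (2/3) 0 \<tau> = k * theta3 u \<tau>"
    using theta_series_char_add [of 0 "1 / 3" 0 \<tau>] theta_series_minus [of 0 u \<tau>] unfolding k3 shift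
    by (simp add: theta_const_def theta_char_eq_theta_series theta3_def)
  assume \<tau>: "Im \<tau> > 0"
  show "theta_deriv_const (1/3) 1 \<tau> = k / h * (theta1_deriv u \<tau> - 2 * of_real pi * \<i> / 3 * theta1 u \<tau>)"
    using theta_series_deriv_char_add [OF \<tau>, of "1 / 2" "- 1 / 3" "1 / 2"] unfolding k1 shift sixth
    by (simp add: theta_deriv_const_eq_theta_series_deriv [OF \<tau>] theta1_deriv_def theta1_def)
qed

lemma theta_const_half_characteristics:
  "theta_const 0 0 \<tau> = theta3 0 \<tau>" "theta_const 0 1 \<tau> = theta4 0 \<tau>" "theta_const 1 0 \<tau> = theta2 0 \<tau>"
  by (simp_all add: theta_const_def theta_char_eq_theta_series theta2_def theta3_def theta4_def)

lemma theta_deriv_const_1_1: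
  assumes "Im \<tau> > 0"
  shows "theta_deriv_const 1 1 \<tau> = theta1_deriv 0 \<tau>"
  by (simp add: theta_deriv_const_eq_theta_series_deriv [OF assms] theta1_deriv_def)

lemma theta1_theta4_third_period_nonzero:
  assumes "Im \<tau> > 0"
  shows "theta1 (- \<tau> / 3) \<tau> \<noteq> 0" "theta4 (- \<tau> / 3) \<tau> \<noteq> 0"
proof -
  have "theta_const (1/3) 1 \<tau> \<noteq> 0" "theta_const (2/3) 1 \<tau> \<noteq> 0"
    using theta_series_at_half_nonzero [OF assms, of "1 / 6"] theta_series_at_half_nonzero [OF assms, of "1 / 3"]
    by (simp_all add: theta_const_def theta_char_eq_theta_series)
  then show "theta1 (- \<tau> / 3) \<tau> \<noteq> 0" "theta4 (- \<tau> / 3) \<tau> \<noteq> 0"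
    unfolding theta_const_third_characteristics by auto
qed

text \<open>
  At a point \<open>u\<close> of order three, \<open>2 u\<close> and \<open>- u\<close> differ by the period \<open>\<tau>\<close>. The duplication formula for \<open>Z\<close> therefore expresses
  \<open>Z(u)\<close> by itself and can be solved; the term \<open>2 \<pi> \<i>\<close> is the quasi-period of \<open>Z\<close>.
\<close>
lemma theta4_log_deriv_third_period:
  fixes \<tau> :: complex
  assumes \<tau>: "Im \<tau> > 0"
  defines "u \<equiv> - \<tau> / 3"
  shows "3 * (theta4_deriv u \<tau> / theta4 u \<tau>) = 2 * of_real pi * \<i> - theta1_deriv 0 \<tau> / theta4 0 \<tau> * (theta1 u \<tau> / theta4 u \<tau>) ^ 3"
proof -
  define q where "q = - exp (2 * of_real pi * \<i> * (\<tau> / 2 + u))"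
  have q: "q \<noteq> 0"
    by (simp add: q_def)
  \<comment> \<open>Oddness of \<open>theta1\<close> and evenness of \<open>theta4\<close> turn the shifted point \<open>- 2 u\<close> into \<open>2 u\<close>.\<close>
  have endpoint: "u + \<tau> = - (2 * u)"
    by (simp add: u_def)
  have *: "theta1 u \<tau> = - q * theta1 (2 * u) \<tau>" "theta4 u \<tau> = q * theta4 (2 * u) \<tau>"
      "theta4_deriv u \<tau> = q * (2 * of_real pi * \<i> * theta4 (2 * u) \<tau> - theta4_deriv (2 * u) \<tau>)"
    using theta1_quasi_period [of u \<tau>] theta4_quasi_period [of u \<tau>] theta4_deriv_quasi_period [OF \<tau>, of u]
    unfolding q_def [symmetric] endpoint by (simp_all add: theta1_minus theta4_minus theta4_deriv_minus [OF \<tau>])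
  have s4: "theta4 u \<tau> \<noteq> 0"
    using theta1_theta4_third_period_nonzero [OF \<tau>] by (simp add: u_def)
  then have u4: "theta4 (2 * u) \<tau> \<noteq> 0"
    using * by auto
  have "theta1 (2 * u) \<tau> / theta4 (2 * u) \<tau> = - (theta1 u \<tau> / theta4 u \<tau>)"
    unfolding * using q by simp
  moreover have "theta4_deriv (2 * u) \<tau> / theta4 (2 * u) \<tau> = 2 * of_real pi * \<i> - theta4_deriv u \<tau> / theta4 u \<tau>"
    unfolding * using q u4 by (simp add: field_simps)
  ultimately show ?thesis
    using theta4_log_deriv_double_argument [OF \<tau> s4 u4] by (simp add: algebra_simps power2_eq_square power3_eq_cube)
qed

text \<open>
  The Wronskian divided by \<open>theta1 z * theta4 z\<close>; this second term is \<open>cn dn / sn\<close> up to normalisation.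
\<close>
lemma theta1_log_deriv_eq_theta4_log_deriv:
  assumes \<tau>: "Im \<tau> > 0" and nz: "theta1 z \<tau> \<noteq> 0" "theta4 z \<tau> \<noteq> 0"
  shows "theta1_deriv z \<tau> / theta1 z \<tau> = theta4_deriv z \<tau> / theta4 z \<tau>
    + theta1_deriv 0 \<tau> * theta4 0 \<tau> / (theta2 0 \<tau> * theta3 0 \<tau>) * (theta2 z \<tau> * theta3 z \<tau> / (theta1 z \<tau> * theta4 z \<tau>))"
proof -
  have "theta2 0 \<tau> * theta3 0 \<tau> \<noteq> 0"
    using theta2_0_nonzero [OF \<tau>] theta3_0_nonzero [OF \<tau>] by simp
  then have "theta1_deriv z \<tau> * theta4 z \<tau> - theta1 z \<tau> * theta4_deriv z \<tau>
      = theta1_deriv 0 \<tau> * theta4 0 \<tau> / (theta2 0 \<tau> * theta3 0 \<tau>) * (theta2 z \<tau> * theta3 z \<tau>)"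
    using wronskian_theta1_theta4 [OF \<tau>, of z] by (simp add: eq_divide_eq)
  moreover have "theta1_deriv z \<tau> / theta1 z \<tau> - theta4_deriv z \<tau> / theta4 z \<tau>
      = (theta1_deriv z \<tau> * theta4 z \<tau> - theta1 z \<tau> * theta4_deriv z \<tau>) / (theta1 z \<tau> * theta4 z \<tau>)"
    using nz by (simp add: diff_frac_eq mult_ac)
  ultimately show ?thesis
    by (simp add: diff_eq_eq add.commute)
qed

theorem theorem6p3:
  fixes \<tau> :: complex
  assumes "Im \<tau> > 0"
  shows "theta_deriv_const (1/3) 1 \<tau> / theta_const (1/3) 1 \<tau> =
           - (1/3) * ((theta_deriv_const 1 1 \<tau> * theta_const (1/3) 1 \<tau> ^ 3)
                      / (theta_const 0 1 \<tau> * theta_const (2/3) 1 \<tau> ^ 3))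
           + (theta_deriv_const 1 1 \<tau> * theta_const 0 1 \<tau>
                * theta_const (1/3) 0 \<tau> * theta_const (2/3) 0 \<tau>)
             / (theta_const 0 0 \<tau> * theta_const 1 0 \<tau>
                * theta_const (1/3) 1 \<tau> * theta_const (2/3) 1 \<tau>)
       \<and> - (1/3) * ((theta_deriv_const 1 1 \<tau> * theta_const (1/3) 1 \<tau> ^ 3)
                      / (theta_const 0 1 \<tau> * theta_const (2/3) 1 \<tau> ^ 3))
           + (theta_deriv_const 1 1 \<tau> * theta_const 0 1 \<tau>
                * theta_const (1/3) 0 \<tau> * theta_const (2/3) 0 \<tau>)
             / (theta_const 0 0 \<tau> * theta_const 1 0 \<tau>
                * theta_const (1/3) 1 \<tau> * theta_const (2/3) 1 \<tau>)
         = of_real pi / 3 * theta_const 0 0 \<tau> * theta_const 1 0 \<tau>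
             * (theta_const (1/3) 1 \<tau> ^ 3 / theta_const (2/3) 1 \<tau> ^ 3)
           - of_real pi * theta_const 0 1 \<tau> ^ 2
             * ((theta_const (1/3) 0 \<tau> * theta_const (2/3) 0 \<tau>)
                / (theta_const (1/3) 1 \<tau> * theta_const (2/3) 1 \<tau>))"
proof -
  define u where "u = - \<tau> / 3"
  define k where "k = exp (2 * of_real pi * \<i> * (\<tau> / 18))"
  define h where "h = exp (2 * of_real pi * \<i> * (1 / 6))"
  have kh: "k \<noteq> 0" "h \<noteq> 0"
    by (simp_all add: k_def h_def)
  have h6: "h ^ 6 = 1"
    unfolding h_def using exp_two_pi_i by (simp add: mult_ac flip: exp_of_nat_mult)
  note third = theta_const_third_characteristics [of \<tau>, folded u_def k_def h_def]
  note nz = theta2_0_nonzero [OF assms] theta3_0_nonzero [OF assms] theta4_0_nonzero [OF assms]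
  have su: "theta1 u \<tau> \<noteq> 0" "theta4 u \<tau> \<noteq> 0"
    using theta1_theta4_third_period_nonzero [OF assms] by (simp_all add: u_def)
  \<comment> \<open>The identity is linear in these two quantities, the analogues of \<open>sn\<^sup>3\<close> and \<open>cn dn / sn\<close> at \<open>u\<close>.\<close>
  define x where "x = theta1 u \<tau> ^ 3 / theta4 u \<tau> ^ 3"
  define y where "y = theta2 u \<tau> * theta3 u \<tau> / (theta1 u \<tau> * theta4 u \<tau>)"
  have x: "theta_const (1/3) 1 \<tau> ^ 3 / theta_const (2/3) 1 \<tau> ^ 3 = x"
  proof -
    have "(k / h * theta1 u \<tau>) ^ 3 / (k * h * theta4 u \<tau>) ^ 3 = x / h ^ 6"
      using kh su by (simp add: x_def field_simps power_mult_distrib flip: power_add)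
    then show ?thesis
      unfolding third h6 by simp
  qed
  have y: "(theta_const (1/3) 0 \<tau> * theta_const (2/3) 0 \<tau>) / (theta_const (1/3) 1 \<tau> * theta_const (2/3) 1 \<tau>) = y"
    unfolding third using kh su by (simp add: y_def field_simps)
  let ?D = "theta1_deriv 0 \<tau>"
  have middle: "- (1/3) * ((theta_deriv_const 1 1 \<tau> * theta_const (1/3) 1 \<tau> ^ 3)
                      / (theta_const 0 1 \<tau> * theta_const (2/3) 1 \<tau> ^ 3))
           + (theta_deriv_const 1 1 \<tau> * theta_const 0 1 \<tau>
                * theta_const (1/3) 0 \<tau> * theta_const (2/3) 0 \<tau>)
             / (theta_const 0 0 \<tau> * theta_const 1 0 \<tau>
                * theta_const (1/3) 1 \<tau> * theta_const (2/3) 1 \<tau>)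
     = - (1/3) * (?D / theta4 0 \<tau> * x) + ?D * theta4 0 \<tau> / (theta2 0 \<tau> * theta3 0 \<tau>) * y"
    unfolding x [symmetric] y [symmetric] theta_const_half_characteristics theta_deriv_const_1_1 [OF assms]
    by (simp add: mult_ac)
  have "theta_deriv_const (1/3) 1 \<tau> / theta_const (1/3) 1 \<tau> = theta1_deriv u \<tau> / theta1 u \<tau> - 2 * of_real pi * \<i> / 3"
    unfolding third(1) third(5) [OF assms] using kh su by (simp add: diff_divide_distrib)
  also have "\<dots> = - (1/3) * (?D / theta4 0 \<tau> * x) + ?D * theta4 0 \<tau> / (theta2 0 \<tau> * theta3 0 \<tau>) * y"
  proof -
    \<comment> \<open>The \<open>2 \<pi> \<i> / 3\<close> from the quasi-period cancels the one from the fractional translation.\<close>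
    have "theta4_deriv u \<tau> / theta4 u \<tau> = (2 * of_real pi * \<i> - ?D / theta4 0 \<tau> * x) / 3"
      using theta4_log_deriv_third_period [OF assms] by (simp add: u_def x_def power_divide mult.commute)
    then show ?thesis
      unfolding theta1_log_deriv_eq_theta4_log_deriv [OF assms su] y_def [symmetric]
      by (simp add: diff_divide_distrib)
  qed
  finally have first: "theta_deriv_const (1/3) 1 \<tau> / theta_const (1/3) 1 \<tau>
      = - (1/3) * (?D / theta4 0 \<tau> * x) + ?D * theta4 0 \<tau> / (theta2 0 \<tau> * theta3 0 \<tau>) * y" .
  have second: "- (1/3) * (?D / theta4 0 \<tau> * x) + ?D * theta4 0 \<tau> / (theta2 0 \<tau> * theta3 0 \<tau>) * y
      = of_real pi / 3 * theta3 0 \<tau> * theta2 0 \<tau> * x - of_real pi * theta4 0 \<tau> ^ 2 * y"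
    unfolding jacobi_derivative_formula [OF assms] using nz by (simp add: field_simps power2_eq_square)
  show ?thesis
    unfolding middle x y using first second by (simp only: theta_const_half_characteristics simp_thms)
qed

end
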